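(* Let $(\succsim_A)_{A\in\Sigma}$ be a family of weak orders on $F$ satisfying axioms (P1½), (P2½), (P3½), (P4½), (P5½) (stated in the context). Then there is a partition of $\Sigma$ into classes of events and an irreflexive, transitive and total (any two distinct classes are comparable) order $\gg$ on the set of classes such that: (1) the lowest class is the class containing the empty event, and it is the singleton $\{\varnothing\}$ (called the trivial class); the highest class is the class containing $S$; (2) if $A,B$ belong to the same non-trivial class, then $A$ and $B$ are both non-null at $A\cup B$; (3) if $A$ belongs to a non-trivial class $\alpha$ and $B$ belongs to a class $\beta$ with $\beta\gg\alpha$, then $A$ is null at $A\cup B$; (4) if $A$ belongs to a non-trivial class $\alpha$, then every event $B\subseteq A$ belongs to a class no higher than $\alpha$, and every event $B\supseteq A$ belongs to a class no lower than $\alpha$; (5) for each class $\alpha$, if $A\in\alpha$ and $B$ belongs to a class no higher than $\alpha$, then $A\cup B\in\alpha$.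
   Context: Framework. $S$ is an infinite set (states), $\Sigma\subseteq 2^S$ is a $\sigma$-algebra (its elements are called events), $O$ is a set (outcomes). $F$ is the set of acts: functions $f:S\to O$ with finite range and $f^{-1}(o)\in\Sigma$ for every $o\in O$. A constant act is an act with constant value. A weak order is a complete and transitive binary relation; for a weak order $\succsim$, $f\succ g$ means $f\succsim g$ and not $g\succsim f$, and $f\sim g$ means $f\succsim g$ and $g\succsim f$. For each event $A$ (including $\varnothing$), $\succsim_A$ is a weak order on $F$. For an event $A$ and acts $f,g$, $fAg$ is the act equal to $f$ on $A$ and to $g$ on $S\setminus A$. $\succsim_A$ agrees with $\succsim_B$ if for all acts $f,g$: $f\succsim_A g\Leftrightarrow f\succsim_B g$. For events $B\subseteq A$, $B$ is null at $A$ if $\succsim_{A\setminus B}$ agrees with $\succsim_A$; otherwise $B$ is non-null at $A$. Axioms. (P1½) For every event $A$ and acts $f,g$: $f\succsim_A g$ implies $fAh\succsim_A gAh$ for every act $h$; and $fAh\succsim_A gAh$ for some act $h$ implies $f\succsim_A g$. (P2½) For all events $B\subseteq A$ and acts $f,g$: $f\succsim_B g$ and $f\succsim_{A\setminus B}g$ imply $f\succsim_A g$; and if $B$ is non-null at $A$, then $f\succ_B g$ and $f\succsim_{A\setminus B}g$ imply $f\succ_A g$. (P3½) For every non-empty event $A$ and constant acts $f,g$: $f\succsim_A g\Leftrightarrow f\succsim_S g$. (P4½) For all events $A,B,C$ with $B,C\subseteq A$ and constant acts $f,f',g,g'$ with $f\succ_S f'$ and $g\succ_S g'$: $fBf'\succsim_A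 fCf'$ implies $gBg'\succsim_A gCg'$. (P5½) There exist constant acts $f,g$ with $f\succ_S g$. *)

theory Defs
  imports "HOL-Analysis.Sigma_Algebra" "HOL-Library.Disjoint_Sets" "HOL-Library.FuncSet"
begin

text \<open>
  Throughout, \<open>S\<close> is the set of states, \<open>E\<close> the \<open>\<sigma>\<close>-algebra of events, \<open>X\<close> the set of outcomes,
  and \<open>R A f g\<close> says that \<open>f\<close> is weakly preferred to \<open>g\<close> conditional on the event \<open>A\<close>.
\<close>

type_synonym ('s, 'o) prefs = "'s set \<Rightarrow> ('s \<Rightarrow> 'o) \<Rightarrow> ('s \<Rightarrow> 'o) \<Rightarrow> bool"

text \<open>Acts are extensional, i.e. \<open>undefined\<close> outside \<open>S\<close>, so that HOL equality of acts is equality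
  of functions on \<open>S\<close>.\<close>

definition acts :: "'s set \<Rightarrow> 's set set \<Rightarrow> 'o set \<Rightarrow> ('s \<Rightarrow> 'o) set" where
  "acts S E X = {f \<in> S \<rightarrow>\<^sub>E X. finite (f ` S) \<and> (\<forall>x\<in>X. f -` {x} \<inter> S \<in> E)}"

definition const_acts :: "'s set \<Rightarrow> 's set set \<Rightarrow> 'o set \<Rightarrow> ('s \<Rightarrow> 'o) set" where
  "const_acts S E X = {f \<in> acts S E X. \<exists>x\<in>X. \<forall>s\<in>S. f s = x}"

text \<open>Completeness is required for equal arguments too, hence includes reflexivity.\<close>

definition weak_order_on :: "'a set \<Rightarrow> ('a \<Rightarrow> 'a \<Rightarrow> bool) \<Rightarrow> bool" where
  "weak_order_on F r \<longleftrightarrow> (\<forall>f\<in>F. \<forall>g\<in>F. r f g \<or> r g f) \<and> transp_on F r"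

definition strict :: "('a \<Rightarrow> 'a \<Rightarrow> bool) \<Rightarrow> 'a \<Rightarrow> 'a \<Rightarrow> bool" where
  "strict r f g \<longleftrightarrow> r f g \<and> \<not> r g f"

text \<open>\<open>mix f A g\<close> is the act written \<open>fAg\<close>; it is extensional whenever \<open>f\<close> and \<open>g\<close> are.\<close>

definition mix :: "('s \<Rightarrow> 'o) \<Rightarrow> 's set \<Rightarrow> ('s \<Rightarrow> 'o) \<Rightarrow> 's \<Rightarrow> 'o" where
  "mix f A g = (\<lambda>s. if s \<in> A then f s else g s)"

definition agrees :: "('s \<Rightarrow> 'o) set \<Rightarrow> ('s, 'o) prefs \<Rightarrow> 's set \<Rightarrow> 's set \<Rightarrow> bool" where
  "agrees F R A B \<longleftrightarrow> (\<forall>f\<in>F. \<forall>g\<in>F. R A f g \<longleftrightarrow> R B f g)"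

text \<open>\<open>null_at F R B A\<close>: \<open>B\<close> is null at \<open>A\<close>. It is only meaningful, and only used, for events
  \<open>B \<subseteq> A\<close>.\<close>

definition null_at :: "('s \<Rightarrow> 'o) set \<Rightarrow> ('s, 'o) prefs \<Rightarrow> 's set \<Rightarrow> 's set \<Rightarrow> bool" where
  "null_at F R B A \<longleftrightarrow> agrees F R (A - B) A"

definition P1_half :: "'s set \<Rightarrow> 's set set \<Rightarrow> 'o set \<Rightarrow> ('s, 'o) prefs \<Rightarrow> bool" where
  "P1_half S E X R \<longleftrightarrow>
    (\<forall>A\<in>E. \<forall>f\<in>acts S E X. \<forall>g\<in>acts S E X.
       (R A f g \<longrightarrow> (\<forall>h\<in>acts S E X. R A (mix f A h) (mix g A h))) \<and>
       ((\<exists>h\<in>acts S E X. R A (mix f A h) (mix g A h)) \<longrightarrow> R A f g))"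

definition P2_half :: "'s set \<Rightarrow> 's set set \<Rightarrow> 'o set \<Rightarrow> ('s, 'o) prefs \<Rightarrow> bool" where
  "P2_half S E X R \<longleftrightarrow>
    (\<forall>A\<in>E. \<forall>B\<in>E. B \<subseteq> A \<longrightarrow> (\<forall>f\<in>acts S E X. \<forall>g\<in>acts S E X.
       (R B f g \<and> R (A - B) f g \<longrightarrow> R A f g) \<and>
       (\<not> null_at (acts S E X) R B A \<longrightarrow>
          strict (R B) f g \<and> R (A - B) f g \<longrightarrow> strict (R A) f g)))"

definition P3_half :: "'s set \<Rightarrow> 's set set \<Rightarrow> 'o set \<Rightarrow> ('s, 'o) prefs \<Rightarrow> bool" where
  "P3_half S E X R \<longleftrightarrow>
    (\<forall>A\<in>E. A \<noteq> {} \<longrightarrow>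
       (\<forall>f\<in>const_acts S E X. \<forall>g\<in>const_acts S E X. R A f g \<longleftrightarrow> R S f g))"

definition P4_half :: "'s set \<Rightarrow> 's set set \<Rightarrow> 'o set \<Rightarrow> ('s, 'o) prefs \<Rightarrow> bool" where
  "P4_half S E X R \<longleftrightarrow>
    (\<forall>A\<in>E. \<forall>B\<in>E. \<forall>C\<in>E. B \<subseteq> A \<and> C \<subseteq> A \<longrightarrow>
       (\<forall>f\<in>const_acts S E X. \<forall>f'\<in>const_acts S E X.
        \<forall>g\<in>const_acts S E X. \<forall>g'\<in>const_acts S E X.
          strict (R S) f f' \<and> strict (R S) g g' \<longrightarrow>
          R A (mix f B f') (mix f C f') \<longrightarrow> R A (mix g B g') (mix g C g')))"

definition P5_half :: "'s set \<Rightarrow> 's set set \<Rightarrow> 'o set \<Rightarrow> ('s, 'o) prefs \<Rightarrow> bool" where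
  "P5_half S E X R \<longleftrightarrow>
    (\<exists>f\<in>const_acts S E X. \<exists>g\<in>const_acts S E X. strict (R S) f g)"

end

theory Submission imports Defs begin

text \<open>
  Fix constant acts \<open>b\<close> and \<open>w\<close> with \<open>b\<close> strictly better than \<open>w\<close>. The betting act that pays \<open>b\<close> on
  \<open>B\<close> and \<open>w\<close> elsewhere detects nullness: \<open>B\<close> is null at \<open>A\<close> exactly when that act is no better
  than \<open>w\<close> itself given \<open>A\<close> (\<open>null_iff_bet_worthless\<close>). Hence the events that are null at a
  non-empty \<open>A\<close> form a proper ideal, and P2\<onehalf> relates the ideals of different events: nullness at \<open>A\<close>
  passes to every larger event, and it passes back from \<open>A'\<close> to \<open>A\<close> provided that \<open>A\<close> itself is
  non-null at \<open>A'\<close>.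

  Now say that \<open>A\<close> is at least as high as \<open>B\<close> if \<open>A\<close> is non-null at \<open>A \<union> B\<close>, or \<open>B\<close> is empty. This is
  a complete preorder on events. It is complete because two events cannot both be null at their
  non-empty union, the ideal there being proper. It is transitive (\<open>at_least_trans\<close>) because any
  three events can be compared through the null ideal of their common union. The classes
  of the theorem are the indifference classes of this preorder, with the induced strict order, and
  the five properties are read off from the definition.
\<close>

section \<open>Indifference classes of a complete preorder\<close>

definition indiff_class :: "'a set \<Rightarrow> ('a \<Rightarrow> 'a \<Rightarrow> bool) \<Rightarrow> 'a \<Rightarrow> 'a set" where
  "indiff_class E ge A = {B \<in> E. ge A B \<and> ge B A}"

definition strictly_higher :: "('a \<Rightarrow> 'a \<Rightarrow> bool) \<Rightarrow> 'a set \<Rightarrow> 'a set \<Rightarrow> bool" where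
  "strictly_higher ge \<alpha> \<beta> \<longleftrightarrow> (\<exists>A\<in>\<alpha>. \<exists>B\<in>\<beta>. \<not> ge B A)"

locale complete_preorder =
  fixes E :: "'a set" and ge :: "'a \<Rightarrow> 'a \<Rightarrow> bool"
  assumes complete: "A \<in> E \<Longrightarrow> B \<in> E \<Longrightarrow> ge A B \<or> ge B A"
    and trans: "A \<in> E \<Longrightarrow> B \<in> E \<Longrightarrow> C \<in> E \<Longrightarrow> ge A B \<Longrightarrow> ge B C \<Longrightarrow> ge A C"
begin

abbreviation classes :: "'a set set" where
  "classes \<equiv> indiff_class E ge ` E"

lemma mem_own_class: "A \<in> E \<Longrightarrow> A \<in> indiff_class E ge A"
  using complete by (auto simp: indiff_class_def)

lemma class_mem: "\<alpha> \<in> classes \<Longrightarrow> A \<in> \<alpha> \<Longrightarrow> A \<in> E"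
  by (auto simp: indiff_class_def)

lemma class_eq:
  assumes "\<alpha> \<in> classes" and "A \<in> \<alpha>"
  shows "\<alpha> = indiff_class E ge A"
  using assms trans unfolding indiff_class_def by blast

lemma strictly_higher_iff:
  assumes "\<alpha> \<in> classes" "\<beta> \<in> classes" "A \<in> \<alpha>" "B \<in> \<beta>"
  shows "strictly_higher ge \<alpha> \<beta> \<longleftrightarrow> \<not> ge B A"
proof
  assume "strictly_higher ge \<alpha> \<beta>"
  then obtain A' B' where *: "A' \<in> \<alpha>" "B' \<in> \<beta>" "\<not> ge B' A'"
    unfolding strictly_higher_def by blast
  have "ge A A'" "ge B' B"
    using * assms class_eq[OF assms(1,3)] class_eq[OF assms(2) *(2)]
    by (auto simp: indiff_class_def)
  then show "\<not> ge B A"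
    using * assms trans class_mem by meson
qed (use assms in \<open>auto simp: strictly_higher_def\<close>)

lemma partition_classes: "partition_on E classes"
proof (rule partition_onI)
  show "\<Union> classes = E"
    using mem_own_class class_mem by blast
  show "{} \<notin> classes"
    using mem_own_class by blast
  show "disjnt \<alpha> \<beta>" if "\<alpha> \<in> classes" "\<beta> \<in> classes" "\<alpha> \<noteq> \<beta>" for \<alpha> \<beta>
    using that class_eq unfolding disjnt_iff by metis
qed

lemma class_nonempty: "\<alpha> \<in> classes \<Longrightarrow> \<exists>A. A \<in> \<alpha>"
  using mem_own_class by blast

lemma irreflp_strictly_higher: "irreflp_on classes (strictly_higher ge)"
proof (rule irreflp_onI)
  fix \<alpha> assume \<alpha>: "\<alpha> \<in> classes"
  obtain A where A: "A \<in> \<alpha>"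
    using \<alpha> class_nonempty by blast
  then have "ge A A"
    using class_mem[OF \<alpha>] complete by blast
  then show "\<not> strictly_higher ge \<alpha> \<alpha>"
    using strictly_higher_iff[OF \<alpha> \<alpha> A A] by blast
qed

lemma transp_strictly_higher: "transp_on classes (strictly_higher ge)"
proof (rule transp_onI)
  fix \<alpha> \<beta> \<gamma>
  assume cl: "\<alpha> \<in> classes" "\<beta> \<in> classes" "\<gamma> \<in> classes"
    and hi: "strictly_higher ge \<alpha> \<beta>" "strictly_higher ge \<beta> \<gamma>"
  obtain A where "A \<in> \<alpha>"
    using cl(1) class_nonempty by blast
  moreover obtain B where "B \<in> \<beta>"
    using cl(2) class_nonempty by blast
  moreover obtain C where "C \<in> \<gamma>"
    using cl(3) class_nonempty by blast
  ultimately have mem: "A \<in> \<alpha>" "B \<in> \<beta>" "C \<in> \<gamma>" .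
  then have E: "A \<in> E" "B \<in> E" "C \<in> E"
    using cl[THEN class_mem] by blast+
  have "\<not> ge B A" "\<not> ge C B"
    using hi strictly_higher_iff[OF cl(1,2) mem(1,2)] strictly_higher_iff[OF cl(2,3) mem(2,3)]
    by simp_all
  then have "\<not> ge C A"
    using E complete trans by blast
  then show "strictly_higher ge \<alpha> \<gamma>"
    using strictly_higher_iff[OF cl(1,3) mem(1,3)] by blast
qed

lemma totalp_strictly_higher: "totalp_on classes (strictly_higher ge)"
proof (rule totalp_onI)
  fix \<alpha> \<beta>
  assume cl: "\<alpha> \<in> classes" "\<beta> \<in> classes" and neq: "\<alpha> \<noteq> \<beta>"
  obtain A where "A \<in> \<alpha>"
    using cl(1) class_nonempty by blast
  moreover obtain B where "B \<in> \<beta>"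
    using cl(2) class_nonempty by blast
  ultimately have mem: "A \<in> \<alpha>" "B \<in> \<beta>" .
  have "\<not> (ge A B \<and> ge B A)"
  proof
    assume "ge A B \<and> ge B A"
    then have "B \<in> \<alpha>"
      using class_eq[OF cl(1) mem(1)] class_mem[OF cl(2) mem(2)]
      by (auto simp: indiff_class_def)
    then show False
      using neq cl mem class_eq by metis
  qed
  then show "strictly_higher ge \<alpha> \<beta> \<or> strictly_higher ge \<beta> \<alpha>"
    using strictly_higher_iff[OF cl mem] strictly_higher_iff[OF cl(2,1) mem(2,1)] by blast
qed

end

section \<open>Null events detected by bets\<close>

lemma mix_in_acts:
  assumes "sigma_algebra S E" "f \<in> acts S E X" "g \<in> acts S E X" "A \<in> E"
  shows "mix f A g \<in> acts S E X"
proof -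
  interpret sigma_algebra S E by fact
  have "A \<subseteq> S"
    using assms sets_into_space by blast
  then have "mix f A g \<in> S \<rightarrow>\<^sub>E X"
    using assms by (auto simp: acts_def mix_def PiE_iff extensional_def)
  moreover have "finite (mix f A g ` S)"
    by (rule finite_subset[of _ "f ` S \<union> g ` S"]) (use assms \<open>A \<subseteq> S\<close> in \<open>auto simp: acts_def mix_def\<close>)
  moreover have "mix f A g -` {x} \<inter> S \<in> E" if "x \<in> X" for x
  proof -
    have "mix f A g -` {x} \<inter> S = ((f -` {x} \<inter> S) \<inter> A) \<union> ((g -` {x} \<inter> S) - A)"
      by (auto simp: mix_def)
    moreover have "f -` {x} \<inter> S \<in> E" "g -` {x} \<inter> S \<in> E"
      using that assms by (auto simp: acts_def)
    ultimately show ?thesis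
      using \<open>A \<in> E\<close> by (simp only: Un Int Diff)
  qed
  ultimately show ?thesis
    by (simp add: acts_def)
qed

locale conditional_preferences = sigma_algebra S E
  for S :: "'s set" and E :: "'s set set" +
  fixes X :: "'o set" and R :: "('s, 'o) prefs" and b w :: "'s \<Rightarrow> 'o"
  assumes weak_order: "A \<in> E \<Longrightarrow> weak_order_on (acts S E X) (R A)"
    and P1: "P1_half S E X R"
    and P2: "P2_half S E X R"
    and P3: "P3_half S E X R"
    and const: "b \<in> const_acts S E X" "w \<in> const_acts S E X"
    and better: "strict (R S) b w"
begin

abbreviation "F \<equiv> acts S E X"

abbreviation null :: "'s set \<Rightarrow> 's set \<Rightarrow> bool" where
  "null B A \<equiv> null_at F R B A"

abbreviation bet :: "'s set \<Rightarrow> 's \<Rightarrow> 'o" where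
  "bet B \<equiv> mix b B w"

lemma bw_acts: "b \<in> F" "w \<in> F"
  using const by (auto simp: const_acts_def)

lemma bet_acts: "B \<in> E \<Longrightarrow> bet B \<in> F"
  using mix_in_acts[OF sigma_algebra_axioms] bw_acts by blast

lemma pref_refl: "A \<in> E \<Longrightarrow> f \<in> F \<Longrightarrow> R A f f"
  using weak_order unfolding weak_order_on_def by blast

lemma pref_trans:
  "A \<in> E \<Longrightarrow> f \<in> F \<Longrightarrow> g \<in> F \<Longrightarrow> h \<in> F \<Longrightarrow> R A f g \<Longrightarrow> R A g h \<Longrightarrow> R A f h"
  using weak_order[of A] unfolding weak_order_on_def transp_on_def by blast

text \<open>If \<open>f = g\<close> on \<open>A\<close> then \<open>fAg = gAg\<close>, so the converse half of P1\<onehalf> reduces the claim to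
  reflexivity.\<close>

lemma pref_if_eq_on:
  assumes "A \<in> E" "f \<in> F" "g \<in> F" and "\<And>s. s \<in> A \<Longrightarrow> f s = g s"
  shows "R A f g"
proof -
  have "mix f A g = mix g A g"
    using assms(4) by (auto simp: mix_def)
  then have "R A (mix f A g) (mix g A g)"
    using assms mix_in_acts[OF sigma_algebra_axioms] pref_refl by metis
  then show ?thesis
    using P1 assms unfolding P1_half_def by blast
qed

lemma strict_better:
  assumes "A \<in> E" "A \<noteq> {}"
  shows "strict (R A) b w"
  using P3 const better assms unfolding P3_half_def strict_def by blast

lemma bet_pref_worse:
  assumes "A \<in> E" "B \<in> E"
  shows "R A (bet B) w"
proof -
  have EI: "A \<inter> B \<in> E" "A - (A \<inter> B) \<in> E"
    using assms by auto
  have "R (A \<inter> B) (bet B) w"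
  proof (cases "A \<inter> B = {}")
    case True
    then show ?thesis
      using pref_if_eq_on[of "A \<inter> B"] EI bet_acts assms bw_acts by auto
  next
    case False
    have "R (A \<inter> B) (bet B) b"
      by (rule pref_if_eq_on) (use EI bet_acts assms bw_acts in \<open>auto simp: mix_def\<close>)
    moreover have "R (A \<inter> B) b w"
      using strict_better[OF EI(1) False] by (simp add: strict_def)
    ultimately show ?thesis
      using pref_trans EI bet_acts assms bw_acts by blast
  qed
  moreover have "R (A - (A \<inter> B)) (bet B) w"
    by (rule pref_if_eq_on) (use EI bet_acts assms bw_acts in \<open>auto simp: mix_def\<close>)
  moreover have "A \<inter> B \<subseteq> A"
    by blast
  ultimately show ?thesis
    using P2 assms EI bet_acts bw_acts unfolding P2_half_def by blast
qed

text \<open>If \<open>B\<close> is null at \<open>A\<close>, the bet can be evaluated at \<open>A - B\<close>, where it coincides with \<open>w\<close>. If \<open>B\<close>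
  is non-null at \<open>A\<close>, it is non-empty, so the bet is strictly better than \<open>w\<close> given \<open>B\<close> by P3\<onehalf>,
  and P2\<onehalf> transfers this strict preference to \<open>A\<close>.\<close>

lemma null_iff_bet_worthless:
  assumes "A \<in> E" "B \<in> E" "B \<subseteq> A"
  shows "null B A \<longleftrightarrow> R A w (bet B)"
proof
  have "R (A - B) w (bet B)"
    by (rule pref_if_eq_on) (use assms bet_acts bw_acts in \<open>auto simp: mix_def\<close>)
  then show "R A w (bet B)" if "null B A"
    using that assms bet_acts bw_acts unfolding null_at_def agrees_def by blast
next
  assume worthless: "R A w (bet B)"
  show "null B A"
  proof (rule ccontr)
    assume nonnull: "\<not> null B A"
    then have "B \<noteq> {}"
      by (auto simp: null_at_def agrees_def)
    moreover have "R B (bet B) b" "R B b (bet B)" "R (A - B) (bet B) w"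
      by (rule pref_if_eq_on; use assms bet_acts bw_acts in \<open>auto simp: mix_def\<close>)+
    ultimately have "strict (R B) (bet B) w" "R (A - B) (bet B) w"
      using strict_better[of B] pref_trans[of B] assms bet_acts bw_acts
      unfolding strict_def by blast+
    then have "strict (R A) (bet B) w"
      using P2 nonnull assms bet_acts bw_acts unfolding P2_half_def by blast
    then show False
      using worthless by (simp add: strict_def)
  qed
qed

section \<open>The null ideals and how they are related\<close>

lemma null_empty: "null {} A"
  by (simp add: null_at_def agrees_def)

lemma nonnull_self:
  assumes "A \<in> E" "A \<noteq> {}"
  shows "\<not> null A A"
proof
  assume "null A A"
  then have "R A w (bet A)"
    using null_iff_bet_worthless assms by blast
  moreover have "R A (bet A) b"
    by (rule pref_if_eq_on) (use assms bet_acts bw_acts in \<open>auto simp: mix_def\<close>)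
  ultimately have "R A w b"
    using pref_trans assms bet_acts bw_acts by blast
  then show False
    using strict_better[OF assms] by (simp add: strict_def)
qed

text \<open>Since \<open>C\<close> is null at \<open>A\<close>, the bet on \<open>B\<close> may be compared with \<open>w\<close> at \<open>A - C\<close>, where the two acts
  coincide.\<close>

lemma null_subset:
  assumes "A \<in> E" "B \<in> E" "C \<in> E" "B \<subseteq> C" "C \<subseteq> A" "null C A"
  shows "null B A"
proof -
  have "R (A - C) w (bet B)"
    by (rule pref_if_eq_on) (use assms bet_acts bw_acts in \<open>auto simp: mix_def\<close>)
  then have "R A w (bet B)"
    using assms bet_acts bw_acts unfolding null_at_def agrees_def by blast
  then show ?thesis
    using null_iff_bet_worthless assms by blast
qed

text \<open>The bets on \<open>B \<union> C\<close> and on \<open>C\<close> differ only on \<open>B\<close>, hence are equally good at \<open>A\<close> when \<open>B\<close> is null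
  there; and the bet on \<open>C\<close> is worthless.\<close>

lemma null_Un:
  assumes "A \<in> E" "B \<in> E" "C \<in> E" "B \<subseteq> A" "C \<subseteq> A" "null B A" "null C A"
  shows "null (B \<union> C) A"
proof -
  have un: "B \<union> C \<in> E"
    using assms by auto
  have "R (A - B) (bet C) (bet (B \<union> C))"
    using assms bet_acts[OF un] bet_acts by (intro pref_if_eq_on) (auto simp: mix_def)
  then have "R A (bet C) (bet (B \<union> C))"
    using assms un bet_acts unfolding null_at_def agrees_def by blast
  moreover have "R A w (bet C)"
    using null_iff_bet_worthless assms by blast
  ultimately have "R A w (bet (B \<union> C))"
    using pref_trans[of A w "bet C"] assms un bet_acts bw_acts by blast
  then show ?thesis
    using null_iff_bet_worthless assms un by blast
qed

lemma null_at_superset: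
  assumes "A \<in> E" "A' \<in> E" "B \<in> E" "B \<subseteq> A" "A \<subseteq> A'" "null B A"
  shows "null B A'"
proof -
  have "R A w (bet B)"
    using null_iff_bet_worthless assms by blast
  moreover have "R (A' - A) w (bet B)"
    by (rule pref_if_eq_on) (use assms bet_acts bw_acts in \<open>auto simp: mix_def\<close>)
  ultimately have "R A' w (bet B)"
    using P2 assms bet_acts bw_acts unfolding P2_half_def by blast
  then show ?thesis
    using null_iff_bet_worthless[of A' B] assms by blast
qed

text \<open>If the bet on \<open>B\<close> had positive value at \<open>A\<close>, the strict half of P2\<onehalf> would carry that value
  over to \<open>A'\<close>, because \<open>A\<close> is non-null there.\<close>

lemma null_at_nonnull_subset:
  assumes "A \<in> E" "A' \<in> E" "B \<in> E" "B \<subseteq> A" "A \<subseteq> A'" "null B A'" "\<not> null A A'"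
  shows "null B A"
proof (rule ccontr)
  assume "\<not> null B A"
  then have "strict (R A) (bet B) w"
    using null_iff_bet_worthless bet_pref_worse assms unfolding strict_def by blast
  moreover have "R (A' - A) (bet B) w"
    by (rule pref_if_eq_on) (use assms bet_acts bw_acts in \<open>auto simp: mix_def\<close>)
  ultimately have "strict (R A') (bet B) w"
    using P2 assms bet_acts bw_acts unfolding P2_half_def by blast
  then show False
    using null_iff_bet_worthless[of A' B] assms unfolding strict_def by blast
qed

section \<open>The preorder of events by height\<close>

text \<open>The empty event is null everywhere, even at itself. The disjunct \<open>B = {}\<close> makes the relation
  reflexive there and puts the empty event below all others.\<close>

definition at_least :: "'s set \<Rightarrow> 's set \<Rightarrow> bool" where
  "at_least A B \<longleftrightarrow> B = {} \<or> \<not> null A (A \<union> B)"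

lemma at_least_superset:
  assumes "A \<in> E" "B \<subseteq> A"
  shows "at_least A B"
proof (cases "B = {}")
  case False
  then have "\<not> null A A" "A \<union> B = A"
    using assms nonnull_self by auto
  then show ?thesis
    by (simp add: at_least_def)
qed (simp add: at_least_def)

lemma empty_at_least_iff: "at_least {} B \<longleftrightarrow> B = {}"
  by (simp add: at_least_def null_empty)

lemma at_least_complete:
  assumes "A \<in> E" "B \<in> E"
  shows "at_least A B \<or> at_least B A"
proof (rule ccontr)
  assume neg: "\<not> ?thesis"
  then have "A \<noteq> {}" "null A (A \<union> B)" "null B (A \<union> B)"
    by (auto simp: at_least_def Un_commute)
  then have "null (A \<union> B) (A \<union> B)"
    using null_Un[of "A \<union> B" A B] assms by auto
  then show False
    using nonnull_self[of "A \<union> B"] assms \<open>A \<noteq> {}\<close> by auto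
qed

text \<open>Everything is compared at the common union \<open>U\<close>. If \<open>A\<close> is null at \<open>A \<union> C\<close>, it is null at \<open>U\<close>.
  Then \<open>B\<close> must be non-null at \<open>U\<close>: otherwise \<open>B \<union> C\<close> would be non-null at \<open>U\<close>, the ideal being
  proper, and the nullness of \<open>B\<close> would descend to \<open>B \<union> C\<close>, although \<open>B\<close> is at least as high as
  \<open>C\<close>. So \<open>A \<union> B\<close>, which contains \<open>B\<close>, is non-null at \<open>U\<close> too, and the nullness of \<open>A\<close> descends to
  \<open>A \<union> B\<close>, although \<open>A\<close> is at least as high as \<open>B\<close>.\<close>

lemma at_least_trans:
  assumes E: "A \<in> E" "B \<in> E" "C \<in> E" and AB: "at_least A B" and BC: "at_least B C"
  shows "at_least A C"
proof (rule ccontr)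
  assume "\<not> at_least A C"
  then have ne: "C \<noteq> {}" and "null A (A \<union> C)"
    by (auto simp: at_least_def)
  then have B: "\<not> null B (B \<union> C)"
    using BC by (auto simp: at_least_def)
  then have "B \<noteq> {}"
    using null_empty by auto
  then have A: "\<not> null A (A \<union> B)"
    using AB by (auto simp: at_least_def)
  define U where "U = A \<union> B \<union> C"
  have U: "U \<in> E" "A \<union> B \<in> E" "A \<union> C \<in> E" "B \<union> C \<in> E" "A \<union> B \<subseteq> U" "A \<union> C \<subseteq> U" "B \<union> C \<subseteq> U"
    using E by (auto simp: U_def)
  have AU: "null A U"
    using null_at_superset[of "A \<union> C" U A] \<open>null A (A \<union> C)\<close> E U by blast
  have BU: "\<not> null B U"
  proof
    assume B_null: "null B U"
    have "\<not> null (B \<union> C) U"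
    proof
      assume "null (B \<union> C) U"
      then have "null (A \<union> (B \<union> C)) U"
        using null_Un[of U A "B \<union> C"] AU E U by blast
      then show False
        using nonnull_self[of U] ne U by (auto simp: U_def Un_assoc)
    qed
    then show False
      using null_at_nonnull_subset[of "B \<union> C" U B] B_null B E U by blast
  qed
  have "\<not> null (A \<union> B) U"
    using null_subset[of U B "A \<union> B"] BU E U by blast
  then show False
    using null_at_nonnull_subset[of "A \<union> B" U A] AU A E U by blast
qed

text \<open>For non-empty \<open>B\<close>, the upper bound \<open>A \<union> B\<close> is no higher than \<open>A\<close> by the very definition of
  \<open>at_least A B\<close>, since \<open>A \<union> (A \<union> B) = A \<union> B\<close>.\<close>

lemma at_least_Un:
  assumes "A \<in> E" "at_least A B"
  shows "at_least A (A \<union> B)"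
  using assms at_least_superset[of A A] by (cases "B = {}") (auto simp: at_least_def)

end

section \<open>The classes of events\<close>

theorem theorem1:
  fixes S :: "'s set" and E :: "'s set set" and X :: "'o set" and R :: "('s, 'o) prefs"
  assumes "infinite S"
    and "sigma_algebra S E"
    and "\<And>A. A \<in> E \<Longrightarrow> weak_order_on (acts S E X) (R A)"
    and "P1_half S E X R"
    and "P2_half S E X R"
    and "P3_half S E X R"
    and "P4_half S E X R"
    and "P5_half S E X R"
  shows "\<exists>(P :: 's set set set) (higher :: 's set set \<Rightarrow> 's set set \<Rightarrow> bool).
    partition_on E P \<and>
    irreflp_on P higher \<and> transp_on P higher \<and> totalp_on P higher \<and>
    ({{}} \<in> P \<and> (\<forall>\<alpha>\<in>P. \<alpha> \<noteq> {{}} \<longrightarrow> higher \<alpha> {{}}) \<and>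
     (\<exists>\<omega>\<in>P. S \<in> \<omega> \<and> (\<forall>\<alpha>\<in>P. \<alpha> \<noteq> \<omega> \<longrightarrow> higher \<omega> \<alpha>))) \<and>
    (\<forall>\<alpha>\<in>P. \<alpha> \<noteq> {{}} \<longrightarrow> (\<forall>A\<in>\<alpha>. \<forall>B\<in>\<alpha>.
       \<not> null_at (acts S E X) R A (A \<union> B) \<and> \<not> null_at (acts S E X) R B (A \<union> B))) \<and>
    (\<forall>\<alpha>\<in>P. \<forall>\<beta>\<in>P. \<alpha> \<noteq> {{}} \<and> higher \<beta> \<alpha> \<longrightarrow>
       (\<forall>A\<in>\<alpha>. \<forall>B\<in>\<beta>. null_at (acts S E X) R A (A \<union> B))) \<and>
    (\<forall>\<alpha>\<in>P. \<alpha> \<noteq> {{}} \<longrightarrow> (\<forall>A\<in>\<alpha>. \<forall>B\<in>E.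
       (B \<subseteq> A \<longrightarrow> (\<exists>\<beta>\<in>P. B \<in> \<beta> \<and> \<not> higher \<beta> \<alpha>)) \<and>
       (A \<subseteq> B \<longrightarrow> (\<exists>\<beta>\<in>P. B \<in> \<beta> \<and> \<not> higher \<alpha> \<beta>)))) \<and>
    (\<forall>\<alpha>\<in>P. \<forall>\<beta>\<in>P. \<not> higher \<beta> \<alpha> \<longrightarrow> (\<forall>A\<in>\<alpha>. \<forall>B\<in>\<beta>. A \<union> B \<in> \<alpha>))"
proof -
  obtain b w where bw: "b \<in> const_acts S E X" "w \<in> const_acts S E X" "strict (R S) b w"
    using \<open>P5_half S E X R\<close> unfolding P5_half_def by blast
  interpret sigma_algebra S E by fact
  interpret conditional_preferences S E X R b w
    by unfold_locales (use assms bw in auto)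
  interpret complete_preorder E at_least
    by unfold_locales (use at_least_complete at_least_trans in blast)+
  let ?hi = "strictly_higher at_least"
  have empty_class: "indiff_class E at_least {} = {{}}"
    using empty_at_least_iff by (auto simp: indiff_class_def)
  then have trivial: "{{}} \<in> classes"
    by (metis empty_sets imageI)
  have nonempty: "A \<noteq> {}" if "\<alpha> \<in> classes" "\<alpha> \<noteq> {{}}" "A \<in> \<alpha>" for \<alpha> A
    using that class_eq empty_class by metis
  have lowest: "\<forall>\<alpha>\<in>classes. \<alpha> \<noteq> {{}} \<longrightarrow> ?hi \<alpha> {{}}"
    using nonempty class_nonempty strictly_higher_iff[OF _ trivial] empty_at_least_iff
    by (metis singletonI)
  have highest: "\<exists>\<omega>\<in>classes. S \<in> \<omega> \<and> (\<forall>\<alpha>\<in>classes. \<alpha> \<noteq> \<omega> \<longrightarrow> ?hi \<omega> \<alpha>)"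
  proof (intro bexI conjI ballI impI)
    let ?\<omega> = "indiff_class E at_least S"
    show \<omega>: "S \<in> ?\<omega>" "?\<omega> \<in> classes"
      using mem_own_class by auto
    fix \<alpha> assume \<alpha>: "\<alpha> \<in> classes" "\<alpha> \<noteq> ?\<omega>"
    obtain A where A: "A \<in> \<alpha>"
      using \<alpha> class_nonempty by blast
    then have "at_least S A"
      using \<alpha> class_mem at_least_superset sets_into_space by blast
    then have "\<not> ?hi \<alpha> ?\<omega>"
      using strictly_higher_iff[OF \<alpha>(1) \<omega>(2) A \<omega>(1)] by blast
    then show "?hi ?\<omega> \<alpha>"
      using \<alpha> \<omega> totalp_strictly_higher unfolding totalp_on_def by blast
  qed
  have same: "\<not> null A (A \<union> B) \<and> \<not> null B (A \<union> B)"
    if "\<alpha> \<in> classes" "\<alpha> \<noteq> {{}}" "A \<in> \<alpha>" "B \<in> \<alpha>" for \<alpha> A B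
  proof -
    have "at_least A B" "at_least B A"
      using that class_eq[of \<alpha> A] by (auto simp: indiff_class_def)
    then show ?thesis
      using nonempty[OF that(1,2)] that(3,4) by (auto simp: at_least_def Un_commute)
  qed
  have diff: "null A (A \<union> B)"
    if "\<alpha> \<in> classes" "\<beta> \<in> classes" "?hi \<beta> \<alpha>" "A \<in> \<alpha>" "B \<in> \<beta>" for \<alpha> \<beta> A B
    using that strictly_higher_iff[of \<beta> \<alpha> B A] by (auto simp: at_least_def)
  have mono: "(B \<subseteq> A \<longrightarrow> (\<exists>\<beta>\<in>classes. B \<in> \<beta> \<and> \<not> ?hi \<beta> \<alpha>)) \<and>
      (A \<subseteq> B \<longrightarrow> (\<exists>\<beta>\<in>classes. B \<in> \<beta> \<and> \<not> ?hi \<alpha> \<beta>))"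
    if "\<alpha> \<in> classes" "A \<in> \<alpha>" "B \<in> E" for \<alpha> A B
  proof -
    have B: "indiff_class E at_least B \<in> classes" "B \<in> indiff_class E at_least B"
      using that(3) mem_own_class by auto
    moreover have "B \<subseteq> A \<Longrightarrow> \<not> ?hi (indiff_class E at_least B) \<alpha>"
      using strictly_higher_iff[OF B(1) that(1) B(2) that(2)]
        at_least_superset[OF class_mem[OF that(1,2)]] by blast
    moreover have "A \<subseteq> B \<Longrightarrow> \<not> ?hi \<alpha> (indiff_class E at_least B)"
      using strictly_higher_iff[OF that(1) B(1) that(2) B(2)]
        at_least_superset[OF that(3)] by blast
    ultimately show ?thesis
      by blast
  qed
  have union: "A \<union> B \<in> \<alpha>"
    if "\<alpha> \<in> classes" "\<beta> \<in> classes" "\<not> ?hi \<beta> \<alpha>" "A \<in> \<alpha>" "B \<in> \<beta>" for \<alpha> \<beta> A B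
  proof -
    have "A \<in> E" "B \<in> E"
      using class_mem[OF that(1,4)] class_mem[OF that(2,5)] .
    moreover have "at_least A B"
      using that(3) strictly_higher_iff[OF that(2,1,5,4)] by blast
    ultimately have "A \<union> B \<in> indiff_class E at_least A"
      using at_least_Un at_least_superset[of "A \<union> B" A] by (auto simp: indiff_class_def)
    then show ?thesis
      using class_eq[OF that(1,4)] by simp
  qed
  show ?thesis
    by (intro exI[of _ classes] exI[of _ ?hi] conjI partition_classes irreflp_strictly_higher
        transp_strictly_higher totalp_strictly_higher trivial lowest highest)
      ((intro ballI impI, (elim conjE)?, (rule same | rule diff | rule mono | rule union); assumption)+)
qed

end
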